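(* Let $k\ge 3$ and $n\ge1$ be integers with $2n+1\le k$. Every Hanoi group $(G,\mathsf{X}_k)$ generated by a set $S\subset\underline{R}_{k,n}$ is contracting.
   Context: Let $\mathsf{X}$ be a finite alphabet and $\mathsf{X}^*$ the set of finite words over $\mathsf{X}$, viewed as a rooted tree; $\operatorname{Aut}\mathsf{X}^*$ is the group of permutations of $\mathsf{X}^*$ preserving word length and common prefixes. For $g\in\operatorname{Aut}\mathsf{X}^*$, the root permutation $\sigma_g\in\operatorname{Sym}(\mathsf{X})$ is the restriction of $g$ to one-letter words, and for $x\in\mathsf{X}$ the section $g|_x\in\operatorname{Aut}\mathsf{X}^*$ is defined by $g(xw)=\sigma_g(x)\,g|_x(w)$ for all $w\in\mathsf{X}^*$. For $w=x_n\ldots x_1$ set $g|_w=(g|_{x_n})|_{x_{n-1}\ldots x_1}$ inductively. A self-similar group $(G,\mathsf{X})$ is a subgroup $G\le\operatorname{Aut}\mathsf{X}^*$ with $g|_x\in G$ for all $g\in G$, $x\in\mathsf{X}$. It is contracting if there is a finite set $\mathcal{N}\subset G$ such that for every $g\in G$ there is $N\in\mathbb{N}$ with $g|_v\in\mathcal{N}$ for all words $v$ with $|v|\ge N$. Let $\mathsf{X}_k=\{0,\dots,k-1\}$. A $k$-peg Hanoi automorphism is an $a\in\operatorname{Aut}\mathsf{X}_k^*$ for which there are disjoint sets $P_a,Q_a$ with $P_a\cup Q_a=\mathsf{X}_k$, $a|_i=1$ for $i\in P_a$, $a|_j=a$ for $j\in Q_a$, and $\sigma_a$ fixing every element of $Q_a$.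 For $a\ne1$ these sets are unique and $Q_a$ is the set of inactive pegs; the set of inactive pegs of the identity is $\mathsf{X}_k$. Let $S_k$ be the set of all $k$-peg Hanoi automorphisms. A $k$-peg Hanoi group $(G,\mathsf{X}_k)$ is a group $G\le\operatorname{Aut}\mathsf{X}_k^*$ together with a fixed generating set $S\subset S_k$, $1\in S$, that is state-closed (contains all sections of its elements). For $2n+1\le k$, $\underline{R}_{k,n}\subset S_k$ is the set consisting of the identity automorphism and all $a\in S_k$ such that (1) $Q_a\subset\{m+1,m+2,\dots,m+n\}$ for some $m$, and (2) whenever $i\in Q_a$, $\sigma_a$ also fixes every element of $\{i-1,i-2,\dots,i-(n-1)\}$; all computations are modulo $k$. *)

theory Defs
  imports "HOL-Algebra.Generated_Groups" "HOL-Combinatorics.Permutations" "HOL-Library.Sublist"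
begin

section \<open>Automorphisms of the tree of words\<close>

text \<open>
  Words over the alphabet \<open>X\<close> are the elements of \<open>lists X\<close>, read from left to right (the
  root letter is the head of the list). Since \<open>permutes\<close> requires a map to be the identity
  outside of \<open>lists X\<close>, equality of tree automorphisms is equality of functions.
\<close>

definition tree_auts :: "'a set \<Rightarrow> ('a list \<Rightarrow> 'a list) set" where
  "tree_auts X = {g. g permutes lists X
     \<and> (\<forall>u\<in>lists X. length (g u) = length u)
     \<and> (\<forall>u\<in>lists X. \<forall>v\<in>lists X.
          length (longest_common_prefix (g u) (g v)) = length (longest_common_prefix u v))}"

definition tree_aut_group :: "'a set \<Rightarrow> ('a list \<Rightarrow> 'a list) monoid" where
  "tree_aut_group X = \<lparr>carrier = tree_auts X, monoid.mult = (\<circ>), one = id\<rparr>"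

definition root_perm :: "('a list \<Rightarrow> 'a list) \<Rightarrow> 'a \<Rightarrow> 'a" where
  "root_perm g x = hd (g [x])"

text \<open>
  The section at a letter; its defining property is lemma \<open>tree_auts_Cons\<close> below. It is again
  the identity outside of \<open>lists X\<close>.
\<close>

definition sect :: "('a list \<Rightarrow> 'a list) \<Rightarrow> 'a \<Rightarrow> 'a list \<Rightarrow> 'a list" where
  "sect g x = (\<lambda>w. tl (g (x # w)))"

primrec sect_word :: "('a list \<Rightarrow> 'a list) \<Rightarrow> 'a list \<Rightarrow> 'a list \<Rightarrow> 'a list" where
  "sect_word g [] = g"
| "sect_word g (x # w) = sect_word (sect g x) w"

lemma tree_auts_permutes: "g \<in> tree_auts X \<Longrightarrow> g permutes lists X"
  by (simp add: tree_auts_def)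

lemma tree_auts_length: "g \<in> tree_auts X \<Longrightarrow> u \<in> lists X \<Longrightarrow> length (g u) = length u"
  by (simp add: tree_auts_def)

lemma tree_auts_lcp:
  "g \<in> tree_auts X \<Longrightarrow> u \<in> lists X \<Longrightarrow> v \<in> lists X \<Longrightarrow>
   length (longest_common_prefix (g u) (g v)) = length (longest_common_prefix u v)"
  by (simp add: tree_auts_def)

lemma tree_auts_Cons:
  assumes g: "g \<in> tree_auts X" and x: "x \<in> X" and w: "w \<in> lists X"
  shows "g (x # w) = root_perm g x # sect g x w"
proof -
  have "length (g [x]) = 1" "length (g (x # w)) = Suc (length w)"
    using tree_auts_length[OF g, of "[x]"] tree_auts_length[OF g, of "x # w"] x w by auto
  then obtain y z v where yz: "g [x] = [y]" "g (x # w) = z # v"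
    by (metis One_nat_def length_0_conv length_Suc_conv)
  have "length (longest_common_prefix (g [x]) (g (x # w))) = 1"
    using tree_auts_lcp[OF g, of "[x]" "x # w"] x w by simp
  then have "y = z" using yz by (simp split: if_splits)
  then show ?thesis using yz by (simp add: root_perm_def sect_def)
qed

lemma group_tree_aut_group: "group (tree_aut_group X)"
proof (rule groupI)
  fix g assume "g \<in> carrier (tree_aut_group X)"
  then have g: "g \<in> tree_auts X" by (simp add: tree_aut_group_def)
  let ?h = "inv_into UNIV g"
  have p: "g permutes lists X" using g by (rule tree_auts_permutes)
  have h: "?h permutes lists X" using p by (rule permutes_inv)
  have gh: "g (?h u) = u" for u using permutes_inverses(1)[OF p] .
  have mem: "?h u \<in> lists X" if "u \<in> lists X" for u
    using permutes_in_image[OF h, of u] that by blast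
  have "?h \<in> tree_auts X"
    unfolding tree_auts_def
    using h tree_auts_length[OF g mem] tree_auts_lcp[OF g mem mem] by (auto simp: gh)
  then show "\<exists>h\<in>carrier (tree_aut_group X). h \<otimes>\<^bsub>tree_aut_group X\<^esub> g = \<one>\<^bsub>tree_aut_group X\<^esub>"
    using permutes_inv_o(2)[OF p] by (auto simp: tree_aut_group_def)
next
  fix g h assume "g \<in> carrier (tree_aut_group X)" "h \<in> carrier (tree_aut_group X)"
  then have gh: "g \<in> tree_auts X" "h \<in> tree_auts X" by (simp_all add: tree_aut_group_def)
  have mem: "h u \<in> lists X" if "u \<in> lists X" for u
    using permutes_in_image[OF tree_auts_permutes[OF gh(2)], of u] that by blast
  have "g \<circ> h \<in> tree_auts X"
    unfolding tree_auts_def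
    using permutes_compose[OF tree_auts_permutes[OF gh(2)] tree_auts_permutes[OF gh(1)]]
      tree_auts_length[OF gh(1) mem] tree_auts_length[OF gh(2)]
      tree_auts_lcp[OF gh(1) mem mem] tree_auts_lcp[OF gh(2)] by auto
  then show "g \<otimes>\<^bsub>tree_aut_group X\<^esub> h \<in> carrier (tree_aut_group X)"
    by (simp add: tree_aut_group_def)
qed (auto simp: tree_aut_group_def tree_auts_def permutes_id comp_assoc)

section \<open>Contracting self-similar groups\<close>

definition self_similar :: "'a set \<Rightarrow> ('a list \<Rightarrow> 'a list) set \<Rightarrow> bool" where
  "self_similar X G \<longleftrightarrow> finite X \<and> subgroup G (tree_aut_group X) \<and> (\<forall>g\<in>G. \<forall>x\<in>X. sect g x \<in> G)"

definition contracting :: "'a set \<Rightarrow> ('a list \<Rightarrow> 'a list) set \<Rightarrow> bool" where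
  "contracting X G \<longleftrightarrow> self_similar X G \<and>
     (\<exists>\<N>. finite \<N> \<and> \<N> \<subseteq> G \<and>
        (\<forall>g\<in>G. \<exists>N. \<forall>v\<in>lists X. length v \<ge> N \<longrightarrow> sect_word g v \<in> \<N>))"

section \<open>Hanoi groups\<close>

definition hanoi_partition :: "nat \<Rightarrow> (nat list \<Rightarrow> nat list) \<Rightarrow> nat set \<Rightarrow> nat set \<Rightarrow> bool" where
  "hanoi_partition k a P Q \<longleftrightarrow> P \<inter> Q = {} \<and> P \<union> Q = {..<k}
     \<and> (\<forall>i\<in>P. sect a i = id) \<and> (\<forall>j\<in>Q. sect a j = a) \<and> (\<forall>j\<in>Q. root_perm a j = j)"

definition hanoi_auts :: "nat \<Rightarrow> (nat list \<Rightarrow> nat list) set" where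
  "hanoi_auts k = {a \<in> tree_auts {..<k}. \<exists>P Q. hanoi_partition k a P Q}"

definition inactive_pegs :: "nat \<Rightarrow> (nat list \<Rightarrow> nat list) \<Rightarrow> nat set" where
  "inactive_pegs k a = (if a = id then {..<k} else (THE Q. \<exists>P. hanoi_partition k a P Q))"

lemma hanoi_partition_unique:
  assumes "a \<noteq> id" "hanoi_partition k a P Q" "hanoi_partition k a P' Q'"
  shows "P = P'" "Q = Q'"
  using assms unfolding hanoi_partition_def by (metis Un_iff disjoint_iff subsetI subset_antisym)+

lemma inactive_pegs_eq:
  assumes "a \<noteq> id" "hanoi_partition k a P Q"
  shows "inactive_pegs k a = Q"
proof -
  have "(THE Q. \<exists>P. hanoi_partition k a P Q) = Q"
    using assms(2) by (intro the_equality) (metis hanoi_partition_unique(2)[OF assms(1)])+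
  then show ?thesis using assms(1) by (simp add: inactive_pegs_def)
qed

definition hanoi_group ::
    "nat \<Rightarrow> (nat list \<Rightarrow> nat list) set \<Rightarrow> (nat list \<Rightarrow> nat list) set \<Rightarrow> bool" where
  "hanoi_group k G S \<longleftrightarrow> subgroup G (tree_aut_group {..<k}) \<and> S \<subseteq> hanoi_auts k
     \<and> id \<in> S \<and> (\<forall>a\<in>S. \<forall>x<k. sect a x \<in> S) \<and> G = generate (tree_aut_group {..<k}) S"

text \<open>
  The set $\underline{R}_{k,n}$, used only for \<open>2 * n + 1 \<le> k\<close>. In the second condition
  \<open>(i + k - j) mod k\<close> is \<open>i - j\<close> modulo \<open>k\<close>, for \<open>j < k\<close>, avoiding truncated subtraction.
\<close>

definition R_lower :: "nat \<Rightarrow> nat \<Rightarrow> (nat list \<Rightarrow> nat list) set" where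
  "R_lower k n = insert id {a \<in> hanoi_auts k.
     (\<exists>m::nat. inactive_pegs k a \<subseteq> (\<lambda>j. (m + j) mod k) ` {1..n}) \<and>
     (\<forall>i\<in>inactive_pegs k a. \<forall>j\<in>{1..n-1}.
        root_perm a ((i + k - j) mod k) = (i + k - j) mod k)}"

end

theory Submission
  imports Defs
begin

text \<open>
  Write an element of a Hanoi group as a word in the generators. Its section at a peg \<open>y\<close> is the
  subword of those letters \<open>a\<close> that find the peg, on its way through the word, in the inactive set
  of \<open>a\<close>; all other letters have trivial section there (\<open>sect_word_prod\<close>). Sections therefore
  never lengthen a word, and the length stays the same only if \<open>y\<close> is inactive for every letter
  (\<open>sect_letters_same_length\<close>). Hence, reading sufficiently many letters of the tree, every word
  arrives at a product of generators with a common inactive peg \<open>x\<close>, and stays there. The union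
  over \<open>x\<close> of these sets absorbs all deep sections, so it suffices that each of them is finite
  (\<open>contracting_if_finite_products\<close>).

  Finiteness is proved by induction on the set \<open>T\<close> of letters (\<open>finite_products\<close>). Let \<open>F\<close> be the
  set of pegs fixed by all of \<open>T\<close>, and suppose that the inactive set of some letter \<open>a\<close> is
  contained in \<open>F\<close>. At a peg \<open>y\<close> of \<open>F\<close> the section is a product of the letters for which \<open>y\<close> is
  inactive. At a peg outside of \<open>F\<close>, which moves outside of \<open>F\<close> forever, the letter \<open>a\<close> is erased.
  So every section uses a smaller set of letters, except at pegs which are inactive for all of \<open>T\<close>,
  where an element is its own section. Such an element is determined by its root permutation and by
  its sections at the remaining pegs, which lie in a finite set by induction.

  The shape of \<open>R_lower\<close> provides the letter \<open>a\<close>. Around a common inactive peg \<open>x\<close> the pegs at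
  cyclic distance less than \<open>n\<close> from \<open>x\<close> form an interval, and every letter fixes all pegs from the
  left end of this interval up to its own rightmost inactive peg (\<open>R_lower_fixes_below\<close>). A letter
  whose rightmost inactive peg is as far left as possible thus has its inactive pegs fixed by all
  letters (\<open>finite_products_common_inactive\<close>).

  The same finiteness, for a single letter, shows that a Hanoi automorphism has finite order. This
  is why products of generators, without inverses, already make up the group
  (\<open>hanoi_group_eq_products\<close>).
\<close>

section \<open>Sections of tree automorphisms\<close>

lemma tree_auts_lists: "g \<in> tree_auts X \<Longrightarrow> g w \<in> lists X \<longleftrightarrow> w \<in> lists X"
  by (rule permutes_in_image[OF tree_auts_permutes])

lemma tree_auts_outside: "g \<in> tree_auts X \<Longrightarrow> w \<notin> lists X \<Longrightarrow> g w = w"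
  using tree_auts_permutes permutes_not_in by metis

lemma id_in_tree_auts: "id \<in> tree_auts X"
  by (simp add: tree_auts_def permutes_id)

lemma comp_in_tree_auts: "g \<in> tree_auts X \<Longrightarrow> h \<in> tree_auts X \<Longrightarrow> g \<circ> h \<in> tree_auts X"
  using monoid.m_closed[OF group.is_monoid[OF group_tree_aut_group], of g X h]
  by (simp add: tree_aut_group_def)

lemma root_perm_id [simp]: "root_perm id y = y"
  by (simp add: root_perm_def)

lemma sect_id [simp]: "sect id y = id"
  by (auto simp: sect_def)

lemma root_perm_in: "g \<in> tree_auts X \<Longrightarrow> y \<in> X \<Longrightarrow> root_perm g y \<in> X"
  using tree_auts_lists[of g X "[y]"] tree_auts_Cons[of g X y "[]"] by auto

lemma root_perm_comp:
  assumes "g \<in> tree_auts X" "h \<in> tree_auts X" "y \<in> X"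
  shows "root_perm (g \<circ> h) y = root_perm g (root_perm h y)"
proof -
  have "sect h y [] = []"
    using tree_auts_length[OF assms(2), of "[y]"] assms(3) by (auto simp: sect_def length_Suc_conv)
  then have "h [y] = [root_perm h y]" using tree_auts_Cons[OF assms(2,3), of "[]"] by simp
  then show ?thesis by (simp add: root_perm_def)
qed

lemma root_perm_inj:
  assumes "g \<in> tree_auts X" "y \<in> X" "z \<in> X" "root_perm g y = root_perm g z"
  shows "y = z"
proof -
  have "length (sect g u []) = 0" if "u \<in> X" for u
    using tree_auts_length[OF assms(1), of "[u]"] that by (simp add: sect_def)
  then have "g [y] = g [z]"
    using tree_auts_Cons[OF assms(1), of _ "[]"] assms by simp
  then show ?thesis using permutes_inj[OF tree_auts_permutes[OF assms(1)]] by (auto dest: injD)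
qed

lemma sect_comp:
  assumes "g \<in> tree_auts X" "h \<in> tree_auts X" "y \<in> X"
  shows "sect (g \<circ> h) y = sect g (root_perm h y) \<circ> sect h y"
proof
  fix w
  show "sect (g \<circ> h) y w = (sect g (root_perm h y) \<circ> sect h y) w"
  proof (cases "w \<in> lists X")
    case True
    then show ?thesis using tree_auts_Cons[OF assms(2,3) True] by (simp add: sect_def)
  next
    case False
    then have out: "u # w \<notin> lists X" for u by auto
    show ?thesis
      using tree_auts_outside[OF assms(1) out] tree_auts_outside[OF assms(2) out]
      by (simp add: sect_def)
  qed
qed

text \<open>
  The alternative in the hypothesis on sections admits self-referential recursions: where both
  automorphisms are their own sections, the induction on words supplies the equality.
\<close>

lemma tree_auts_eqI:
  assumes g: "g \<in> tree_auts X" and h: "h \<in> tree_auts X"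
    and root: "\<And>y. y \<in> X \<Longrightarrow> root_perm g y = root_perm h y"
    and sec: "\<And>y. y \<in> X \<Longrightarrow> sect g y = sect h y \<or> sect g y = g \<and> sect h y = h"
  shows "g = h"
proof
  fix w
  show "g w = h w"
  proof (cases "w \<in> lists X")
    case True
    then show ?thesis
    proof (induction w)
      case Nil
      then show ?case using tree_auts_length[OF g, of "[]"] tree_auts_length[OF h, of "[]"] by simp
    next
      case (Cons y w)
      then show ?case
        using tree_auts_Cons[OF g Cons.hyps(1), of w] tree_auts_Cons[OF h Cons.hyps(1), of w]
          root[of y] sec[of y] by auto
    qed
  next
    case False
    then show ?thesis using tree_auts_outside[OF g] tree_auts_outside[OF h] by simp
  qed
qed

text \<open>
  Elements of \<open>A\<close> reproduce themselves at the letters in \<open>C\<close>, so the root permutation and the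
  sections at the other letters determine them, and there are only finitely many choices for these.
\<close>

lemma finite_if_sections_finite:
  assumes fin: "finite X" "finite B" and A: "A \<subseteq> tree_auts X"
    and self: "\<And>g y. g \<in> A \<Longrightarrow> y \<in> C \<Longrightarrow> sect g y = g"
    and B: "\<And>g y. g \<in> A \<Longrightarrow> y \<in> X - C \<Longrightarrow> sect g y \<in> B"
  shows "finite A"
proof -
  \<comment> \<open>The value \<open>id\<close> is a dummy at the letters where the section carries no information.\<close>
  define f where "f g = (\<lambda>y\<in>X. (root_perm g y, if y \<in> C then id else sect g y))" for g
  have "f ` A \<subseteq> (\<Pi>\<^sub>E y\<in>X. X \<times> insert id B)"
    using A B by (auto simp: f_def root_perm_in subset_iff)
  then have "finite (f ` A)"
    by (rule finite_subset) (use fin in \<open>auto intro!: finite_PiE\<close>)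
  moreover have "inj_on f A"
  proof (rule inj_onI)
    fix g h assume gh: "g \<in> A" "h \<in> A" "f g = f h"
    have eq: "root_perm g y = root_perm h y \<and> (y \<notin> C \<longrightarrow> sect g y = sect h y)" if "y \<in> X" for y
      using fun_cong[OF gh(3), of y] that by (auto simp: f_def split: if_splits)
    show "g = h"
      by (rule tree_auts_eqI[of _ X]) (use A gh eq self in blast)+
  qed
  ultimately show ?thesis by (rule finite_imageD)
qed

section \<open>Products of Hanoi automorphisms\<close>

text \<open>
  The identity has several Hanoi partitions, but \<open>inactive_pegs\<close> is one of their \<open>Q\<close>-parts also
  in that case, so that no later statement has to treat the identity separately.
\<close>

lemma hanoi_partition_inactive_pegs:
  assumes "a \<in> hanoi_auts k"
  shows "\<exists>P. hanoi_partition k a P (inactive_pegs k a)"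
proof (cases "a = id")
  case True
  then have "hanoi_partition k a {} (inactive_pegs k a)"
    by (simp add: hanoi_partition_def inactive_pegs_def)
  then show ?thesis ..
next
  case False
  then show ?thesis using assms inactive_pegs_eq by (auto simp: hanoi_auts_def)
qed

lemma
  assumes "a \<in> hanoi_auts k"
  shows inactive_pegs_subset: "inactive_pegs k a \<subseteq> {..<k}"
    and root_perm_inactive: "y \<in> inactive_pegs k a \<Longrightarrow> root_perm a y = y"
    and sect_hanoi: "y < k \<Longrightarrow> sect a y = (if y \<in> inactive_pegs k a then a else id)"
  using hanoi_partition_inactive_pegs[OF assms] unfolding hanoi_partition_def by auto

lemma hanoi_tree_auts: "a \<in> hanoi_auts k \<Longrightarrow> a \<in> tree_auts {..<k}"
  by (simp add: hanoi_auts_def)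

lemma finite_hanoi_auts: "finite (hanoi_auts k)"
proof -
  have "finite {a \<in> hanoi_auts k. inactive_pegs k a = Q}" for Q
    by (rule finite_if_sections_finite[of "{..<k}" "{id}" _ Q])
      (use inactive_pegs_subset in \<open>auto simp: hanoi_tree_auts sect_hanoi subset_iff\<close>)
  then have "finite (\<Union>Q\<in>Pow {..<k}. {a \<in> hanoi_auts k. inactive_pegs k a = Q})" by blast
  then show ?thesis by (rule rev_finite_subset) (use inactive_pegs_subset in auto)
qed

text \<open>
  As maps compose from right to left, it is the last letter of a word that acts first.
\<close>

definition word_prod :: "('a \<Rightarrow> 'a) list \<Rightarrow> 'a \<Rightarrow> 'a" where
  "word_prod ws = foldr (\<circ>) ws id"

text \<open>
  This is the monoid generated by \<open>T\<close>; presenting its elements by words without inverses keeps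
  control of lengths and of the letters that occur.
\<close>

definition products :: "('a \<Rightarrow> 'a) set \<Rightarrow> ('a \<Rightarrow> 'a) set" where
  "products T = word_prod ` lists T"

lemma word_prod_simps [simp]:
  "word_prod [] = id" "word_prod (a # ws) = a \<circ> word_prod ws"
  by (simp_all add: word_prod_def)

lemma word_prod_in_products: "set ws \<subseteq> T \<Longrightarrow> word_prod ws \<in> products T"
  unfolding products_def by (rule imageI) auto

lemma productsE:
  assumes "g \<in> products T"
  obtains ws where "g = word_prod ws" "set ws \<subseteq> T"
  using assms unfolding products_def by blast

lemma word_prod_append: "word_prod (us @ vs) = word_prod us \<circ> word_prod vs"
  by (induction us) (simp_all add: comp_assoc)

lemma id_in_products: "id \<in> products T"
  unfolding products_def by (rule image_eqI[of _ _ "[]"]) simp_all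

lemma products_base: "a \<in> T \<Longrightarrow> a \<in> products T"
  unfolding products_def by (rule image_eqI[of _ _ "[a]"]) simp_all

lemma products_comp: "g \<in> products T \<Longrightarrow> h \<in> products T \<Longrightarrow> g \<circ> h \<in> products T"
  unfolding products_def by (auto simp flip: word_prod_append intro!: imageI)

lemma products_mono: "T \<subseteq> U \<Longrightarrow> products T \<subseteq> products U"
  unfolding products_def by (intro image_mono lists_mono)

lemma word_prod_tree_auts: "set ws \<subseteq> hanoi_auts k \<Longrightarrow> word_prod ws \<in> tree_auts {..<k}"
  by (induction ws) (auto intro: id_in_tree_auts comp_in_tree_auts hanoi_tree_auts)

text \<open>
  The letters surviving in the section at \<open>y\<close>: a letter is kept if the image of \<open>y\<close> under the part
  of the word acting before it is one of its inactive pegs.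
\<close>

primrec sect_letters ::
    "nat \<Rightarrow> (nat list \<Rightarrow> nat list) list \<Rightarrow> nat \<Rightarrow> (nat list \<Rightarrow> nat list) list" where
  "sect_letters k [] y = []"
| "sect_letters k (a # ws) y =
     (if root_perm (word_prod ws) y \<in> inactive_pegs k a then a # sect_letters k ws y
      else sect_letters k ws y)"

lemma sect_word_prod:
  assumes "set ws \<subseteq> hanoi_auts k" "y < k"
  shows "sect (word_prod ws) y = word_prod (sect_letters k ws y)"
  using assms(1)
proof (induction ws)
  case (Cons a ws)
  have ws: "word_prod ws \<in> tree_auts {..<k}" and a: "a \<in> hanoi_auts k"
    using Cons.prems word_prod_tree_auts by auto
  have z: "root_perm (word_prod ws) y < k" using root_perm_in[OF ws, of y] assms(2) by simp
  have "sect (word_prod (a # ws)) y = sect a (root_perm (word_prod ws) y) \<circ> sect (word_prod ws) y"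
    unfolding word_prod_simps by (rule sect_comp[OF hanoi_tree_auts[OF a] ws]) (use assms(2) in simp)
  moreover have "sect (word_prod ws) y = word_prod (sect_letters k ws y)" using Cons by simp
  ultimately have "sect (word_prod (a # ws)) y = word_prod (sect_letters k (a # ws) y)"
    by (simp add: sect_hanoi[OF a z])
  then show ?case .
qed simp

lemma set_sect_letters: "set (sect_letters k ws y) \<subseteq> set ws"
  by (induction ws) auto

lemma length_sect_letters: "length (sect_letters k ws y) \<le> length ws"
  by (induction ws) auto

lemma root_perm_word_prod_fixed:
  assumes "set ws \<subseteq> hanoi_auts k" "y < k" "\<And>b. b \<in> set ws \<Longrightarrow> root_perm b y = y"
  shows "root_perm (word_prod ws) y = y"
  using assms(1,3)
proof (induction ws)
  case (Cons a ws)
  have "root_perm (word_prod (a # ws)) y = root_perm a (root_perm (word_prod ws) y)"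
    unfolding word_prod_simps
    by (rule root_perm_comp[OF hanoi_tree_auts word_prod_tree_auts]) (use Cons assms(2) in auto)
  then have "root_perm (word_prod (a # ws)) y = y" using Cons by simp
  then show ?case .
qed simp

lemma sect_letters_fixed:
  assumes "set ws \<subseteq> hanoi_auts k" "y < k" "\<And>b. b \<in> set ws \<Longrightarrow> root_perm b y = y"
  shows "sect_letters k ws y = filter (\<lambda>b. y \<in> inactive_pegs k b) ws"
  using assms(1,3)
proof (induction ws)
  case (Cons a ws)
  then have "root_perm (word_prod ws) y = y"
    using assms(2) by (intro root_perm_word_prod_fixed) auto
  then show ?case using Cons by simp
qed simp

text \<open>
  If no letter is erased, then every letter meets the peg among its inactive pegs, which it fixes.
  So the peg never moves and is inactive for all letters.
\<close>

lemma sect_letters_same_length: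
  assumes "set ws \<subseteq> hanoi_auts k" "y < k" "length (sect_letters k ws y) = length ws"
  shows "\<forall>b\<in>set ws. y \<in> inactive_pegs k b"
  using assms(1,3)
proof (induction ws)
  case (Cons a ws)
  have full: "root_perm (word_prod ws) y \<in> inactive_pegs k a"
    and len: "length (sect_letters k ws y) = length ws"
    using Cons.prems length_sect_letters[of k ws y] by (auto split: if_splits)
  have IH: "\<forall>b\<in>set ws. y \<in> inactive_pegs k b" using Cons len by auto
  then have "root_perm (word_prod ws) y = y"
    using Cons.prems(1) assms(2)
    by (intro root_perm_word_prod_fixed) (auto intro: root_perm_inactive)
  then show ?case using full IH by simp
qed simp

lemma products_sect:
  assumes "T \<subseteq> hanoi_auts k" "g \<in> products T" "y < k"
  shows "sect g y \<in> products T"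
proof -
  obtain ws where "g = word_prod ws" "set ws \<subseteq> T"
    using assms(2) by (rule productsE)
  then have "sect g y = word_prod (sect_letters k ws y)" "set (sect_letters k ws y) \<subseteq> T"
    using assms sect_word_prod[of ws k y] set_sect_letters[of k ws y] by auto
  then show ?thesis using word_prod_in_products by simp
qed

lemma products_sect_word:
  assumes "T \<subseteq> hanoi_auts k" "g \<in> products T" "v \<in> lists {..<k}"
  shows "sect_word g v \<in> products T"
  using assms(3,2) by (induction v arbitrary: g) (auto intro: products_sect[OF assms(1)])

text \<open>
  Every word over \<open>T\<close> permutes the pegs and fixes \<open>F\<close> pointwise, so a peg that starts outside of \<open>F\<close> never
  enters \<open>F\<close>. A letter all of whose inactive pegs lie in \<open>F\<close> is therefore erased.
\<close>

lemma sect_letters_moved: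
  assumes ws: "set ws \<subseteq> T" and T: "T \<subseteq> hanoi_auts k"
    and F: "F \<subseteq> {..<k}" "\<And>b z. b \<in> T \<Longrightarrow> z \<in> F \<Longrightarrow> root_perm b z = z"
    and y: "y < k" "y \<notin> F"
  shows "set (sect_letters k ws y) \<subseteq> {b \<in> T. \<not> inactive_pegs k b \<subseteq> F}"
proof -
  have notF: "root_perm (word_prod us) y \<notin> F" if "set us \<subseteq> T" for us
  proof
    let ?g = "word_prod us"
    assume z: "root_perm ?g y \<in> F"
    have us: "set us \<subseteq> hanoi_auts k" using that T by auto
    have "root_perm ?g (root_perm ?g y) = root_perm ?g y"
      using z F that by (intro root_perm_word_prod_fixed[OF us]) auto
    then have "root_perm ?g y = y"
      using root_perm_inj[OF word_prod_tree_auts[OF us]] z F(1) y(1) by blast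
    then show False using z y by simp
  qed
  show ?thesis using ws by (induction ws) (use notF in auto)
qed

text \<open>
  The hypothesis is demanded of all subsets of \<open>T\<close> because passing to sections shrinks the set of
  letters, and the induction then needs a letter to erase in the smaller set. The three kinds of
  pegs in the proof are: those in \<open>C\<close>, where an element is its own section; those in \<open>F - C\<close>, where
  the letters not containing the peg are lost; and those outside of \<open>F\<close>, where \<open>a\<close> is lost.
\<close>

lemma finite_products:
  assumes "finite T" "T \<subseteq> hanoi_auts k"
    and fixed: "\<And>U. U \<subseteq> T \<Longrightarrow> U \<noteq> {} \<Longrightarrow>
      \<exists>a\<in>U. \<forall>b\<in>U. \<forall>q\<in>inactive_pegs k a. root_perm b q = q"
  shows "finite (products T)"
  using assms
proof (induction T rule: finite_psubset_induct)
  case (psubset T)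
  show ?case
  proof (cases "T = {}")
    case True
    then show ?thesis by (simp add: products_def)
  next
    case False
    define F where "F = {y. y < k \<and> (\<forall>b\<in>T. root_perm b y = y)}"
    define C where "C = {y. y < k \<and> (\<forall>b\<in>T. y \<in> inactive_pegs k b)}"
    define B where "B = (\<Union>U\<in>{U. U \<subset> T}. products U)"
    obtain a where a: "a \<in> T" "inactive_pegs k a \<subseteq> F"
      using psubset.prems(2)[OF order.refl False] psubset.prems(1) inactive_pegs_subset
      unfolding F_def by blast
    have "finite {U. U \<subset> T}"
      by (rule finite_subset[of _ "Pow T"]) (use psubset.hyps in auto)
    moreover have "finite (products U)" if "U \<subset> T" for U
      using that psubset.prems by (intro psubset.IH) (auto intro: psubset.prems(2))
    ultimately have finB: "finite B" by (simp add: B_def)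
    have sec: "(y \<in> C \<longrightarrow> sect g y = g) \<and> (y \<notin> C \<longrightarrow> sect g y \<in> B)"
      if g: "g \<in> products T" and y: "y < k" for g y
    proof -
      obtain ws where ws: "g = word_prod ws" "set ws \<subseteq> T"
        using g by (rule productsE)
      have wsk: "set ws \<subseteq> hanoi_auts k" using ws psubset.prems by auto
      have s: "sect g y = word_prod (sect_letters k ws y)"
        using sect_word_prod[OF wsk y] ws by simp
      have inB: "sect g y \<in> B" if "set (sect_letters k ws y) \<subseteq> U" "U \<subset> T" for U
        unfolding s B_def by (rule UN_I[of U]) (use that word_prod_in_products in blast)+
      show ?thesis
      proof (cases "y \<in> F")
        case True
        then have eq: "sect_letters k ws y = filter (\<lambda>b. y \<in> inactive_pegs k b) ws"
          using ws by (intro sect_letters_fixed[OF wsk y]) (auto simp: F_def)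
        show ?thesis
        proof (cases "y \<in> C")
          case True
          then have "sect_letters k ws y = ws"
            using ws by (auto simp: eq C_def intro!: filter_True)
          then show ?thesis using True s ws by simp
        next
          case False
          have "sect g y \<in> B"
            by (rule inB[of "{b \<in> T. y \<in> inactive_pegs k b}"])
              (use ws y False in \<open>auto simp: eq C_def\<close>)
          then show ?thesis using False by simp
        qed
      next
        case False
        have sub: "set (sect_letters k ws y) \<subseteq> {b \<in> T. \<not> inactive_pegs k b \<subseteq> F}"
          by (rule sect_letters_moved[OF ws(2) psubset.prems(1) _ _ y False]) (auto simp: F_def)
        have "sect g y \<in> B" by (rule inB[OF sub]) (use a in auto)
        moreover have "y \<notin> C"
          using False y root_perm_inactive psubset.prems(1) unfolding C_def F_def by blast
        ultimately show ?thesis by simp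
      qed
    qed
    show ?thesis
    proof (rule finite_if_sections_finite[of "{..<k}" B _ C])
      show "products T \<subseteq> tree_auts {..<k}"
        using psubset.prems(1) word_prod_tree_auts by (fastforce simp: products_def)
    qed (use finB sec in \<open>auto simp: C_def\<close>)
  qed
qed

text \<open>
  A letter fixes its own inactive pegs, so \<open>finite_products\<close> applies to \<open>{a}\<close>: two powers of \<open>a\<close>
  coincide, \<open>a\<close> has finite order, and its inverse is a power of \<open>a\<close>.
\<close>

lemma inv_in_products:
  assumes a: "a \<in> hanoi_auts k"
  shows "inv_into UNIV a \<in> products {a}"
proof -
  have bij: "bij a" using permutes_bij[OF tree_auts_permutes[OF hanoi_tree_auts[OF a]]] .
  have pow: "a ^^ i \<in> products {a}" for i
  proof (induction i)
    case 0
    show ?case unfolding funpow.simps by (rule id_in_products)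
  next
    case (Suc i)
    show ?case unfolding funpow.simps by (intro products_comp products_base Suc.IH singletonI)
  qed
  have "finite (products {a})"
    using a root_perm_inactive by (intro finite_products[of _ k]) (auto dest: subset_singletonD)
  then have "finite (range (\<lambda>i::nat. a ^^ i))"
    by (rule rev_finite_subset) (use pow in auto)
  then have "\<not> inj (\<lambda>i::nat. a ^^ i)" using finite_imageD infinite_UNIV_nat by blast
  then obtain i j where ij: "i < j" "a ^^ i = a ^^ j"
    unfolding inj_def by (metis linorder_neqE_nat)
  have "a ^^ i \<circ> a ^^ (j - i) = a ^^ i"
    unfolding funpow_add[symmetric] using ij by simp
  moreover have "inj (a ^^ i)" using bij by (simp add: bij_is_inj)
  ultimately have "a ^^ (j - i) = id" by (simp add: fun_eq_iff inj_eq)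
  moreover have "j - i = Suc (j - i - 1)" using ij by simp
  ultimately have "a \<circ> a ^^ (j - i - 1) = id" by (metis funpow.simps(2))
  then have "inv_into UNIV a = a ^^ (j - i - 1)"
    using bij by (metis bij_def comp_assoc comp_id id_comp inv_o_cancel)
  then show ?thesis using pow by simp
qed

lemma hanoi_group_eq_products:
  assumes "hanoi_group k G S"
  shows "G = products S"
proof
  let ?T = "tree_aut_group {..<k}"
  have S: "S \<subseteq> hanoi_auts k" and G: "G = generate ?T S" "subgroup G ?T"
    using assms by (auto simp: hanoi_group_def)
  show "G \<subseteq> products S"
  proof
    fix g assume "g \<in> G"
    then show "g \<in> products S"
      unfolding G(1)
    proof (induction g rule: generate.induct)
      case one
      show ?case unfolding tree_aut_group_def monoid.simps by (rule id_in_products)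
    next
      case (incl h)
      then show ?case by (rule products_base)
    next
      case (inv h)
      then have h: "h \<in> hanoi_auts k" using S by auto
      have p: "h permutes lists {..<k}" by (rule tree_auts_permutes[OF hanoi_tree_auts[OF h]])
      let ?i = "inv\<^bsub>?T\<^esub> h"
      have "?i \<circ> h = id"
        using group.l_inv[OF group_tree_aut_group, of h "{..<k}"] hanoi_tree_auts[OF h]
        by (simp add: tree_aut_group_def)
      then have "?i = inv_into UNIV h"
        using permutes_bij[OF p] by (metis bij_is_surj comp_assoc comp_id id_comp surj_iff)
      then show ?case using inv_in_products[OF h] products_mono[of "{h}" S] inv by auto
    next
      case (eng g h)
      then have "g \<circ> h \<in> products S" by (intro products_comp)
      then show ?case unfolding tree_aut_group_def monoid.simps .
    qed
  qed
  show "products S \<subseteq> G"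
  proof
    fix g assume "g \<in> products S"
    then obtain ws where ws: "g = word_prod ws" "set ws \<subseteq> S" by (rule productsE)
    have one: "id \<in> G" and mult: "\<And>g h. g \<in> G \<Longrightarrow> h \<in> G \<Longrightarrow> g \<circ> h \<in> G"
      using subgroup.one_closed[OF G(2)] subgroup.m_closed[OF G(2)]
      by (simp_all add: tree_aut_group_def)
    have "S \<subseteq> G" unfolding G(1) by (auto intro: generate.incl)
    \<comment> \<open>The induction presents products as eta-expanded functions, into which the deleted rules would
      unfold the composition.\<close>
    then have "word_prod us \<in> G" if "set us \<subseteq> S" for us
      using that by (induction us) (use one mult in \<open>auto simp del: id_apply comp_apply\<close>)
    then show "g \<in> G" using ws by simp
  qed
qed

section \<open>Contraction from finite sets of products\<close>

text \<open>
  The identity is removed from the letters because all pegs are inactive for it, whatever the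
  constraints on the inactive sets of the other generators; it contributes nothing to a product.
\<close>

lemma contracting_if_finite_products:
  assumes G: "hanoi_group k G S" and k: "k > 0"
    and fin: "\<And>x. x < k \<Longrightarrow> finite (products {a \<in> S - {id}. x \<in> inactive_pegs k a})"
  shows "contracting {..<k} G"
proof -
  define T where "T x = {a \<in> S - {id}. x \<in> inactive_pegs k a}" for x
  define N where "N = (\<Union>x<k. products (T x))"
  have S: "S \<subseteq> hanoi_auts k" and sub: "subgroup G (tree_aut_group {..<k})"
    using G by (auto simp: hanoi_group_def)
  have GS: "G = products S" by (rule hanoi_group_eq_products[OF G])
  have TS: "T x \<subseteq> S" for x by (auto simp: T_def)
  \<comment> \<open>Each letter read either shortens the word or finds it in some \<open>products (T y)\<close>, which is closed
    under sections; so a path as long as the word suffices.\<close>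
  have deep: "sect_word (word_prod ws) v \<in> N"
    if "set ws \<subseteq> S - {id}" "v \<in> lists {..<k}" "length ws \<le> length v" for ws v
    using that(2,1,3)
  proof (induction v arbitrary: ws)
    case Nil
    then have "sect_word (word_prod ws) [] = id" by simp
    moreover have "id \<in> N" unfolding N_def by (rule UN_I[of 0]) (use k id_in_products in blast)+
    ultimately show ?case by metis
  next
    case (Cons y v)
    have y: "y < k" and wsk: "set ws \<subseteq> hanoi_auts k" using Cons S by auto
    show ?case
    proof (cases "length (sect_letters k ws y) = length ws")
      case True
      have "word_prod ws \<in> products (T y)"
        unfolding T_def
        by (rule word_prod_in_products) (use sect_letters_same_length[OF wsk y True] Cons.prems(1) in blast)
      moreover have "y # v \<in> lists {..<k}" using Cons.hyps by auto
      ultimately have "sect_word (word_prod ws) (y # v) \<in> products (T y)"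
        using TS S by (intro products_sect_word[of _ k]) blast+
      then show ?thesis using y by (auto simp: N_def)
    next
      case False
      then have "length (sect_letters k ws y) \<le> length v"
        using length_sect_letters[of k ws y] Cons.prems by simp
      moreover have "set (sect_letters k ws y) \<subseteq> S - {id}"
        using set_sect_letters[of k ws y] Cons.prems by blast
      ultimately have "sect_word (word_prod (sect_letters k ws y)) v \<in> N"
        using Cons.IH by blast
      then show ?thesis using sect_word_prod[OF wsk y] by simp
    qed
  qed
  have "\<exists>N0. \<forall>v\<in>lists {..<k}. length v \<ge> N0 \<longrightarrow> sect_word g v \<in> N" if g: "g \<in> G" for g
  proof -
    have drop_id: "word_prod (filter (\<lambda>a. a \<noteq> id) ws) = word_prod ws"
      for ws :: "(nat list \<Rightarrow> nat list) list"
      by (induction ws) auto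
    obtain ws where "g = word_prod ws" "set ws \<subseteq> S"
      using g unfolding GS by (rule productsE)
    then have "g = word_prod (filter (\<lambda>a. a \<noteq> id) ws)"
      "set (filter (\<lambda>a. a \<noteq> id) ws) \<subseteq> S - {id}"
      using drop_id by auto
    then show ?thesis using deep by metis
  qed
  moreover have "finite N" using fin by (simp add: N_def T_def)
  moreover have "N \<subseteq> G" using products_mono[OF TS] GS by (auto simp: N_def)
  moreover have "self_similar {..<k} G"
    using sub products_sect[OF S] GS by (simp add: self_similar_def)
  ultimately show ?thesis unfolding contracting_def by blast
qed

section \<open>The cyclic order around a common inactive peg\<close>

text \<open>
  The position of \<open>i\<close> in the cyclic order that starts at \<open>x - (n - 1)\<close>, so that \<open>x\<close> has position
  \<open>n - 1\<close>. Starting there places every set that contains \<open>x\<close> and lies in a cyclic interval of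
  length \<open>n\<close> at the positions from \<open>0\<close> to \<open>2 * n - 2\<close>, without wrapping around modulo \<open>k\<close>
  if \<open>2 * n - 1 \<le> k\<close>.
\<close>

definition offset :: "nat \<Rightarrow> nat \<Rightarrow> nat \<Rightarrow> nat \<Rightarrow> nat" where
  "offset k n x i = (i + (k - x) + (n - 1)) mod k"

lemma int_offset:
  assumes "x < k" "n \<ge> 1"
  shows "int (offset k n x i) = (int i - int x + (int n - 1)) mod int k"
proof -
  have "int (offset k n x i) = (int i - int x + (int n - 1) + int k) mod int k"
    using assms by (simp add: offset_def of_nat_mod of_nat_diff algebra_simps)
  then show ?thesis by simp
qed

text \<open>
  Translates between integer congruences and the form in which \<open>R_lower\<close> expresses the peg \<open>u - j\<close>.
\<close>

lemma minus_mod_eqI: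
  assumes "i < k" "j \<le> k" "(int u - int j) mod int k = int i mod int k"
  shows "(u + k - j) mod k = i"
proof -
  have "int ((u + k - j) mod k) = (int u - int j + int k) mod int k"
    using assms(2) by (simp add: of_nat_mod of_nat_diff algebra_simps)
  also have "\<dots> = int i" using assms(1,3) by simp
  finally show ?thesis by simp
qed

text \<open>
  The automorphism fixes \<open>x\<close> and the \<open>n - 1\<close> pegs before it, that is the positions \<open>0, \<dots>, n - 1\<close>;
  likewise it fixes \<open>q\<close> and the \<open>n - 1\<close> pegs before it. As \<open>q\<close> is at most \<open>n - 1\<close> positions
  after \<open>x\<close>, these two blocks leave no gap up to \<open>q\<close>.
\<close>

lemma R_lower_fixes_below:
  assumes nk: "n \<ge> 1" "2 * n + 1 \<le> k"
    and a: "a \<in> R_lower k n" "a \<noteq> id"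
    and x: "x \<in> inactive_pegs k a" and q: "q \<in> inactive_pegs k a"
    and i: "i < k" "offset k n x i \<le> offset k n x q"
  shows "root_perm a i = i"
proof -
  have aH: "a \<in> hanoi_auts k" using a by (auto simp: R_lower_def)
  have xk: "x < k" using inactive_pegs_subset[OF aH] x by auto
  obtain m where m: "inactive_pegs k a \<subseteq> (\<lambda>j. (m + j) mod k) ` {1..n}"
    using a by (auto simp: R_lower_def)
  \<comment> \<open>Extends the fixing condition of \<open>R_lower\<close> to \<open>j = 0\<close>, where it is part of being inactive.\<close>
  have fix_back: "root_perm a i = i"
    if u: "u \<in> inactive_pegs k a" and j: "j \<le> n - 1"
      and eq: "(int u - int j) mod int k = int i mod int k" for u j
  proof (cases "j = 0")
    case True
    have "u < k" using u inactive_pegs_subset[OF aH] by auto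
    then have "u = i" using eq i(1) True by simp
    then show ?thesis using root_perm_inactive[OF aH u] by simp
  next
    case False
    have "root_perm a ((u + k - j) mod k) = (u + k - j) mod k"
      using a u j False unfolding R_lower_def by simp
    then show ?thesis using minus_mod_eqI[OF i(1) _ eq] j nk by simp
  qed
  \<comment> \<open>Both pegs lie in one interval of length \<open>n\<close>, so the position of \<open>q\<close> is \<open>s - t + n - 1\<close>, a number
    between \<open>0\<close> and \<open>2 * n - 2\<close> that needs no reduction modulo \<open>k\<close>.\<close>
  obtain s where s: "s \<in> {1..n}" "q = (m + s) mod k" using m q by blast
  obtain t where t: "t \<in> {1..n}" "x = (m + t) mod k" using m x by blast
  let ?p = "\<lambda>i. int (offset k n x i)"
  have pi: "?p i = (int i - int x + (int n - 1)) mod int k" for i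
    by (rule int_offset[OF xk nk(1)])
  have "(int q - int x) mod int k = ((int m + int s) - (int m + int t)) mod int k"
    unfolding s(2) t(2) by (simp only: of_nat_mod of_nat_add mod_diff_eq)
  then have "(int q - int x + (int n - 1)) mod int k
      = ((int m + int s) - (int m + int t) + (int n - 1)) mod int k"
    by (rule mod_add_cong) simp
  then have "?p q = (int s - int t + int n - 1) mod int k"
    unfolding pi by (simp add: algebra_simps)
  then have pq: "?p q = int s - int t + int n - 1"
    using s(1) t(1) nk by (subst (asm) mod_pos_pos_trivial) auto
  show ?thesis
  proof (cases "offset k n x i \<le> n - 1")
    case True
    show ?thesis
    proof (rule fix_back[OF x])
      show "(int x - int (n - 1 - offset k n x i)) mod int k = int i mod int k"
      proof -
        have "int x - int (n - 1 - offset k n x i) = ?p i + (int x - (int n - 1))"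
          using True nk(1) by simp
        also have "\<dots> mod int k = (int i - int x + (int n - 1) + (int x - (int n - 1))) mod int k"
          unfolding pi by (rule mod_add_left_eq)
        finally show ?thesis by simp
      qed
    qed simp
  next
    case False
    show ?thesis
    proof (rule fix_back[OF q])
      show "(int q - int (offset k n x q - offset k n x i)) mod int k = int i mod int k"
      proof -
        have "int (offset k n x q - offset k n x i) = ?p q - ?p i" using i(2) by simp
        then have "(int q - int (offset k n x q - offset k n x i)) mod int k
            = (int q - (int q - int x + (int n - 1) - (int i - int x + (int n - 1)))) mod int k"
          unfolding pi by (metis mod_diff_eq mod_diff_right_eq)
        then show ?thesis by simp
      qed
      show "offset k n x q - offset k n x i \<le> n - 1"
        using False pq s(1) t(1) nk by auto
    qed
  qed
qed

text \<open>
  Among the letters of a subset \<open>U\<close>, take one whose last inactive peg, in the order of \<open>offset\<close>, comes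
  first. Every other letter reaches at least as far and fixes everything up to there.
\<close>

lemma finite_products_common_inactive:
  assumes nk: "n \<ge> 1" "2 * n + 1 \<le> k"
    and S: "S \<subseteq> R_lower k n" "S \<subseteq> hanoi_auts k"
  shows "finite (products {a \<in> S - {id}. x \<in> inactive_pegs k a})"
proof (rule finite_products)
  show "finite {a \<in> S - {id}. x \<in> inactive_pegs k a}"
    using S(2) by (auto intro: finite_subset[OF _ finite_hanoi_auts])
  show "{a \<in> S - {id}. x \<in> inactive_pegs k a} \<subseteq> hanoi_auts k" using S by auto
next
  fix U assume U: "U \<subseteq> {a \<in> S - {id}. x \<in> inactive_pegs k a}" "U \<noteq> {}"
  let ?top = "\<lambda>a. Max (offset k n x ` inactive_pegs k a)"
  obtain a where a: "a \<in> U" "\<And>b. b \<in> U \<Longrightarrow> ?top a \<le> ?top b"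
    using ex_has_least_nat[of "\<lambda>a. a \<in> U" _ ?top] U(2) by blast
  have "root_perm b q = q" if b: "b \<in> U" and q: "q \<in> inactive_pegs k a" for b q
  proof -
    have UH: "c \<in> hanoi_auts k" if "c \<in> U" for c using that U(1) S(2) by blast
    have fin: "finite (inactive_pegs k c)" if "c \<in> U" for c
      by (rule finite_subset[OF inactive_pegs_subset[OF UH[OF that]] finite_lessThan])
    have bU: "b \<in> R_lower k n" "b \<noteq> id" "x \<in> inactive_pegs k b"
      using b U(1) S(1) by auto
    have "q < k" using q inactive_pegs_subset[OF UH[OF a(1)]] by auto
    have "?top b \<in> offset k n x ` inactive_pegs k b" using fin[OF b] bU by (intro Max_in) auto
    then obtain r where r: "r \<in> inactive_pegs k b" "?top b = offset k n x r" by auto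
    have "offset k n x q \<le> ?top a" using fin[OF a(1)] q by (intro Max_ge) auto
    then have "offset k n x q \<le> offset k n x r" using a(2)[OF b] r(2) by simp
    then show ?thesis using R_lower_fixes_below[OF nk bU(1,2,3) r(1) \<open>q < k\<close>] by simp
  qed
  then show "\<exists>a\<in>U. \<forall>b\<in>U. \<forall>q\<in>inactive_pegs k a. root_perm b q = q" using a(1) by blast
qed

theorem proposition6p3:
  fixes k n :: nat and G S :: "(nat list \<Rightarrow> nat list) set"
  assumes "k \<ge> 3" and "n \<ge> 1" and "2 * n + 1 \<le> k"
    and "hanoi_group k G S"
    and "S \<subseteq> R_lower k n"
  shows "contracting {..<k} G"
proof (rule contracting_if_finite_products[OF assms(4)])
  have "S \<subseteq> hanoi_auts k" using assms(4) by (simp add: hanoi_group_def)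
  then show "finite (products {a \<in> S - {id}. x \<in> inactive_pegs k a})" for x
    by (rule finite_products_common_inactive[OF assms(2,3,5)])
qed (use assms(1) in simp)

end
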